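(* Every finitely generated virtually free group is a special co-ET0L group.
   Context: **Check stack pushdown automata (cspda).** A cspda $M$ over a finite input alphabet $A$ is a non-deterministic finite-state automaton (with a finite set of states, a single initial state, and a subset of accepting states) with a one-way input tape, a check stack with finite alphabet $\Delta$ and a pushdown stack with finite alphabet $\Gamma$. A computation has two stages. - First stage (initialisation): starting from the initial state, $M$ non-deterministically pushes symbols onto the check stack under the control of its finite-state control. It does not read input and does not use the pushdown stack. (So the possible check stack contents form a regular language.) - Second stage: the check stack is never altered. $M$ may read letters from the input tape and push symbols onto, or pop symbols from, the pushdown stack. The read-write head is always at the top of the pushdown stack and at the corresponding height on the check stack (it moves up by one on both when a symbol is pushed and down by one when a symbol is popped). Each transition depends on the current state, the top pushdown symbol, the check stack symbol at the same height, and, if it is a reading transition, the next input letter, which is consumed. It changes the state and may push or pop. $M$ accepts $w\in A^*$ if some computation enters an accepting state at some stage after reading all of $w$; $L(M)$ is the set of accepted words. A configuration consists of the state and the contents of the two stacks. **Special cspda.** $M$ is special if (P1)–(P7) hold. - (P1) Each state is either reading (all its out-transitions read an input letter) or non-reading (none of its out-transitions reads an input letter). - (P2) The operation of $M$ throughout the second stage is deterministic. - (P3) $\Delta$ and $\Gamma$ both contain a bottom-of-stack symbol $\mathfrak b$ and a padding symbol $\mathsf p$, and $\Delta$ contains a top-of-stack symbol $\mathfrak t$. After initialisation the check stack has $\mathfrak b$ at the bottom and $\mathfrak t$ at the top. The first transition of the second stage writes $\mathfrak b$ at the bottom of the pushdown stack, after which $M$ moves into a reading state. The symbol $\mathfrak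 b$ occurs only at the bottoms of the two stacks, $\mathfrak t$ occurs only at the top of the check stack, $\mathfrak b$ is never popped, and when $\mathfrak t$ is seen on the check stack no symbol can be pushed (so the head never moves above the top of the check stack). - (P4) No computation contains an infinitely long sequence of non-reading transitions in the second stage. - (P5) All accepting states are reading states. - (P6) For every entry configuration $C$ and all $u,v\in A^*$ with $v\notin L(M)$, either $C^{uv}=C^u$ or $C^{uv}$ fails. - (P7) The accepting states are exactly the reading states that are not entry states. Terminology used here: a configuration is reading (accepting) if its state is reading (accepting). An entry configuration is one arising immediately after the first transition of the second stage (the one writing $\mathfrak b$ on the pushdown stack), and its state is an entry state. A failing configuration is a non-accepting reading configuration from which no accepting configuration can be reached. For a reading configuration $C$ and $w\in A^*$, $C^w$ is the configuration of $M$, run in the second stage from $C$ on input $w$, as it enters its first reading state after reading all of $w$ (so $C^{\epsilon}=C$ for the empty word $\epsilon$). $C^w$ fails if a failing configuration is entered in this process, or if the machine gets stuck before reaching such a reading state. **Special co-ET0L groups.** A language accepted by a special cspda is a special ET0L language. For a group $G$ with finite inverse-closed generating set $A$, $\mathsf{coWP}(G,A)=\{w\in A^*: w\neq_G 1\}$. A finitely generated group $G$ is a special co-ET0L group if, for some finite inverse-closed generating set $A$ of $G$, some special cspda with input alphabet $A$ (and, by convention, $A\subseteq\Delta$, $A\subseteq\Gamma$) accepts $\mathsf{coWP}(G,A)$. *)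

theory Defs
  imports "HOL-Algebra.Generated_Groups"
begin

section \<open>Free and virtually free groups\<close>

text \<open>
  A letter \<^term>\<open>(x, True)\<close> stands for the generator \<^term>\<open>x\<close>, and
  \<^term>\<open>(x, False)\<close> for its inverse.
\<close>

definition inv_letter :: "'x \<times> bool \<Rightarrow> 'x \<times> bool" where
  "inv_letter l = (fst l, \<not> snd l)"

definition reduced_word :: "('x \<times> bool) list \<Rightarrow> bool" where
  "reduced_word w \<longleftrightarrow> (\<forall>i. Suc i < length w \<longrightarrow> w ! Suc i \<noteq> inv_letter (w ! i))"

fun cons_reduce :: "'x \<times> bool \<Rightarrow> ('x \<times> bool) list \<Rightarrow> ('x \<times> bool) list" where
  "cons_reduce l [] = [l]"
| "cons_reduce l (m # w) = (if m = inv_letter l then w else l # m # w)"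

text \<open>For reduced words \<open>u\<close> and \<open>v\<close>, \<^term>\<open>foldr cons_reduce u v\<close> is the reduced form of
  the concatenation of \<open>u\<close> and \<open>v\<close>.\<close>

definition free_group :: "'x set \<Rightarrow> ('x \<times> bool) list monoid" where
  "free_group X =
     \<lparr>carrier = {w \<in> lists (X \<times> UNIV). reduced_word w},
      monoid.mult = (\<lambda>u v. foldr cons_reduce u v),
      one = []\<rparr>"

text \<open>A free basis of \<open>G\<close> is a subset of \<open>G\<close>, so it is no restriction that the basis below
  has the type of the group elements.\<close>

definition is_free_group :: "('a, 'b) monoid_scheme \<Rightarrow> bool" where
  "is_free_group G \<longleftrightarrow> group G \<and> (\<exists>X :: 'a set. free_group X \<cong> G)"

definition virtually_free :: "('a, 'b) monoid_scheme \<Rightarrow> bool" where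
  "virtually_free G \<longleftrightarrow>
     (\<exists>H. subgroup H G \<and> finite (rcosets\<^bsub>G\<^esub> H) \<and> is_free_group (G\<lparr>carrier := H\<rparr>))"

lemma inv_letter_inv_letter [simp]: "inv_letter (inv_letter l) = l"
  by (simp add: inv_letter_def)

lemma inv_letter_neq [simp]: "inv_letter l \<noteq> l" "l \<noteq> inv_letter l"
  by (auto simp: inv_letter_def prod_eq_iff)

lemma reduced_word_Nil [simp]: "reduced_word []"
  by (simp add: reduced_word_def)

lemma reduced_word_single [simp]: "reduced_word [l]"
  by (simp add: reduced_word_def)

lemma reduced_word_Cons_Cons [simp]:
  "reduced_word (l # m # w) \<longleftrightarrow> m \<noteq> inv_letter l \<and> reduced_word (m # w)"
  by (auto simp: reduced_word_def nth_Cons split: nat.splits)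

lemma reduced_word_tl: "reduced_word (l # w) \<Longrightarrow> reduced_word w"
  by (cases w) auto

lemma reduced_cons_reduce: "reduced_word w \<Longrightarrow> reduced_word (cons_reduce l w)"
  by (cases w) (auto dest: reduced_word_tl)

lemma reduced_foldr_cons_reduce: "reduced_word v \<Longrightarrow> reduced_word (foldr cons_reduce u v)"
  by (induction u) (auto intro: reduced_cons_reduce)

lemma cons_reduce_inverse:
  assumes "reduced_word w"
  shows "cons_reduce l (cons_reduce (inv_letter l) w) = w"
proof (cases w)
  case (Cons m v)
  then show ?thesis using assms by (cases v) auto
qed simp

lemma cons_reduce_inverse': "reduced_word w \<Longrightarrow> cons_reduce (inv_letter l) (cons_reduce l w) = w"
  using cons_reduce_inverse[of w "inv_letter l"] by simp

lemma foldr_cons_reduce_cons_reduce: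
  assumes "reduced_word w"
  shows "foldr cons_reduce (cons_reduce l s) w = cons_reduce l (foldr cons_reduce s w)"
proof (cases s)
  case (Cons m v)
  then show ?thesis
    using cons_reduce_inverse[OF reduced_foldr_cons_reduce[OF assms]] by auto
qed simp

lemma foldr_cons_reduce_assoc:
  "reduced_word w \<Longrightarrow>
     foldr cons_reduce (foldr cons_reduce u v) w = foldr cons_reduce u (foldr cons_reduce v w)"
  by (induction u) (auto simp: foldr_cons_reduce_cons_reduce)

lemma cons_reduce_reduced: "reduced_word (l # w) \<Longrightarrow> cons_reduce l w = l # w"
  by (cases w) auto

lemma foldr_cons_reduce_Nil: "reduced_word w \<Longrightarrow> foldr cons_reduce w [] = w"
proof (induction w)
  case (Cons l w)
  then have "foldr cons_reduce w [] = w"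
    by (blast dest: reduced_word_tl)
  then show ?case
    using Cons.prems by (simp add: cons_reduce_reduced)
qed simp

lemma foldr_cons_reduce_left_inverse:
  "reduced_word w \<Longrightarrow> foldr cons_reduce (rev (map inv_letter w)) (foldr cons_reduce w v) = v"
  if "reduced_word v"
  using that
  by (induction w)
    (auto simp: cons_reduce_inverse' reduced_foldr_cons_reduce dest: reduced_word_tl)

lemma cons_reduce_in_lists:
  "l \<in> X \<times> UNIV \<Longrightarrow> w \<in> lists (X \<times> UNIV) \<Longrightarrow> cons_reduce l w \<in> lists (X \<times> UNIV)"
  by (cases w) auto

lemma foldr_cons_reduce_in_lists:
  "u \<in> lists (X \<times> UNIV) \<Longrightarrow> v \<in> lists (X \<times> UNIV) \<Longrightarrow>
     foldr cons_reduce u v \<in> lists (X \<times> UNIV)"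
proof (induction u)
  case (Cons l u)
  then have "l \<in> X \<times> UNIV" "foldr cons_reduce u v \<in> lists (X \<times> UNIV)"
    by simp_all
  from cons_reduce_in_lists[OF this] show ?case
    by (simp only: foldr.simps o_apply)
qed simp

lemma group_free_group: "group (free_group X)"
proof (rule groupI)
  fix u assume u: "u \<in> carrier (free_group X)"
  define v where "v = foldr cons_reduce (rev (map inv_letter u)) []"
  have "rev (map inv_letter u) \<in> lists (X \<times> UNIV)"
    using u by (fastforce simp: free_group_def inv_letter_def)
  then have "v \<in> carrier (free_group X)"
    using foldr_cons_reduce_in_lists[of _ X "[]"] reduced_foldr_cons_reduce[of "[]"]
    by (simp add: v_def free_group_def del: in_lists_conv_set)
  moreover have "foldr cons_reduce v u = []"
    using u foldr_cons_reduce_left_inverse[of "[]" u]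
    by (simp add: v_def foldr_cons_reduce_assoc free_group_def foldr_cons_reduce_Nil)
  ultimately show "\<exists>v \<in> carrier (free_group X). v \<otimes>\<^bsub>free_group X\<^esub> u = \<one>\<^bsub>free_group X\<^esub>"
    by (auto simp: free_group_def)
qed (simp_all add: free_group_def foldr_cons_reduce_assoc foldr_cons_reduce_in_lists
      reduced_foldr_cons_reduce del: in_lists_conv_set)


section \<open>Check stack pushdown automata\<close>

datatype 's action = Push 's | Pop | Stay

text \<open>
  \<^item> \<open>(q, d, q') \<in> first_transitions M\<close>: in the first stage, move from \<open>q\<close> to \<open>q'\<close>
    while pushing \<open>d\<close> onto the check stack.
  \<^item> \<open>(q, x, d, i, q', a) \<in> second_transitions M\<close>: in the second stage, move from \<open>q\<close> to \<open>q'\<close> while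
    performing \<open>a\<close> on the pushdown stack, provided that \<open>x\<close> is the top symbol of the pushdown
    stack and \<open>d\<close> the check stack symbol at the same height; \<open>i\<close> is the input letter consumed,
    and \<^term>\<open>None\<close> for a transition that does not read. The value \<^term>\<open>None\<close> of \<open>x\<close> means
    that the pushdown stack is empty, and \<^term>\<open>None\<close> as the value of \<open>d\<close> means that the check
    stack has no symbol at the height of the head.

  The first stage ends when the first second stage transition is made.
\<close>

record ('q, 'a, 's) cspda =
  states :: "'q set"
  input_alphabet :: "'a set"
  check_alphabet :: "'s set"
  pushdown_alphabet :: "'s set"
  initial_state :: 'q
  accepting :: "'q set"
  first_transitions :: "('q \<times> 's \<times> 'q) set"
  second_transitions :: "('q \<times> 's option \<times> 's option \<times> 'a option \<times> 'q \<times> 's action) set"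

definition is_cspda :: "('q, 'a, 's) cspda \<Rightarrow> bool" where
  "is_cspda M \<longleftrightarrow>
     finite (states M) \<and> finite (input_alphabet M) \<and>
     finite (check_alphabet M) \<and> finite (pushdown_alphabet M) \<and>
     initial_state M \<in> states M \<and> accepting M \<subseteq> states M \<and>
     first_transitions M \<subseteq> states M \<times> check_alphabet M \<times> states M \<and>
     (\<forall>(q, x, d, i, q', a) \<in> second_transitions M.
        q \<in> states M \<and> q' \<in> states M \<and>
        set_option x \<subseteq> pushdown_alphabet M \<and> set_option d \<subseteq> check_alphabet M \<and>
        set_option i \<subseteq> input_alphabet M \<and> set_action a \<subseteq> pushdown_alphabet M)"

text \<open>
  A configuration consists of the state, the check stack and the pushdown stack. The check stack
  is listed from bottom to top, the pushdown stack from top to bottom.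
\<close>

type_synonym ('q, 's) config = "'q \<times> 's list \<times> 's list"

inductive first_stage :: "('q, 'a, 's) cspda \<Rightarrow> 'q \<Rightarrow> 's list \<Rightarrow> bool" for M where
  start: "first_stage M (initial_state M) []"
| push: "first_stage M q cs \<Longrightarrow> (q, d, q') \<in> first_transitions M \<Longrightarrow> first_stage M q' (cs @ [d])"

definition top_symbol :: "'s list \<Rightarrow> 's option" where
  "top_symbol ps = (case ps of [] \<Rightarrow> None | x # _ \<Rightarrow> Some x)"

definition symbol_at_height :: "'s list \<Rightarrow> nat \<Rightarrow> 's option" where
  "symbol_at_height cs h = (if 1 \<le> h \<and> h \<le> length cs then Some (cs ! (h - 1)) else None)"

inductive perform :: "'s action \<Rightarrow> 's list \<Rightarrow> 's list \<Rightarrow> bool" where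
  "perform (Push x) ps (x # ps)"
| "perform Pop (x # ps) ps"
| "perform Stay ps ps"

inductive step ::
  "('q, 'a, 's) cspda \<Rightarrow> ('q, 's) config \<Rightarrow> 'a option \<Rightarrow> ('q, 's) config \<Rightarrow> bool" for M where
  "(q, top_symbol ps, symbol_at_height cs (length ps), i, q', a) \<in> second_transitions M \<Longrightarrow>
     perform a ps ps' \<Longrightarrow> step M (q, cs, ps) i (q', cs, ps')"

text \<open>\<open>run M C w D\<close>: in the second stage, \<open>M\<close> can move from \<open>C\<close> to \<open>D\<close> in finitely many
  transitions that read exactly \<open>w\<close>.\<close>

inductive run ::
  "('q, 'a, 's) cspda \<Rightarrow> ('q, 's) config \<Rightarrow> 'a list \<Rightarrow> ('q, 's) config \<Rightarrow> bool" for M where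
  run_refl: "run M C [] C"
| run_silent: "step M C None C' \<Longrightarrow> run M C' w D \<Longrightarrow> run M C w D"
| run_read: "step M C (Some a) C' \<Longrightarrow> run M C' w D \<Longrightarrow> run M C (a # w) D"

definition reachable :: "('q, 'a, 's) cspda \<Rightarrow> 'a list \<Rightarrow> ('q, 's) config \<Rightarrow> bool" where
  "reachable M w D \<longleftrightarrow> (\<exists>q cs. first_stage M q cs \<and> run M (q, cs, []) w D)"

definition language :: "('q, 'a, 's) cspda \<Rightarrow> 'a list set" where
  "language M =
     {w \<in> lists (input_alphabet M). \<exists>D. reachable M w D \<and> fst D \<in> accepting M}"


section \<open>Special cspda\<close>

text \<open>A state without out-transitions is both reading and non-reading.\<close>

definition reading :: "('q, 'a, 's) cspda \<Rightarrow> 'q \<Rightarrow> bool" where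
  "reading M q \<longleftrightarrow>
     (\<forall>d q'. (q, d, q') \<notin> first_transitions M) \<and>
     (\<forall>x d i q' a. (q, x, d, i, q', a) \<in> second_transitions M \<longrightarrow> i \<noteq> None)"

definition non_reading :: "('q, 'a, 's) cspda \<Rightarrow> 'q \<Rightarrow> bool" where
  "non_reading M q \<longleftrightarrow> (\<forall>x d i q' a. (q, x, d, i, q', a) \<in> second_transitions M \<longrightarrow> i = None)"

definition entry_config :: "('q, 'a, 's) cspda \<Rightarrow> ('q, 's) config \<Rightarrow> bool" where
  "entry_config M C \<longleftrightarrow> (\<exists>q cs i. first_stage M q cs \<and> step M (q, cs, []) i C)"

definition entry_state :: "('q, 'a, 's) cspda \<Rightarrow> 'q \<Rightarrow> bool" where
  "entry_state M q \<longleftrightarrow> (\<exists>cs ps. entry_config M (q, cs, ps))"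

definition failing :: "('q, 'a, 's) cspda \<Rightarrow> ('q, 's) config \<Rightarrow> bool" where
  "failing M C \<longleftrightarrow>
     reading M (fst C) \<and> fst C \<notin> accepting M \<and>
     \<not> (\<exists>w D. run M C w D \<and> fst D \<in> accepting M)"

text \<open>
  \<open>config_after M C w D\<close> says that \<open>C\<^sup>w\<close> exists and equals \<open>D\<close>. That \<open>D\<close> is the \<^emph>\<open>first\<close> reading
  configuration after \<open>w\<close> has been read needs no extra clause: a reading configuration admits no
  transition that does not read (lemma \<open>run_Nil_reading\<close> below).
\<close>

definition config_after ::
  "('q, 'a, 's) cspda \<Rightarrow> ('q, 's) config \<Rightarrow> 'a list \<Rightarrow> ('q, 's) config \<Rightarrow> bool" where
  "config_after M C w D \<longleftrightarrow> run M C w D \<and> reading M (fst D)"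

lemma run_Nil_reading:
  assumes "run M C [] D" "reading M (fst C)"
  shows "D = C"
  using assms by cases (fastforce simp: reading_def elim!: step.cases)+

text \<open>\<open>stuck M C w\<close>: with \<open>w\<close> still to be read, \<open>C\<close> admits no transition, and it is not a reading
  configuration in which all input has been read.\<close>

definition stuck :: "('q, 'a, 's) cspda \<Rightarrow> ('q, 's) config \<Rightarrow> 'a list \<Rightarrow> bool" where
  "stuck M C w \<longleftrightarrow>
     \<not> (\<exists>D. step M C None D) \<and>
     (case w of [] \<Rightarrow> \<not> reading M (fst C) | a # _ \<Rightarrow> \<not> (\<exists>D. step M C (Some a) D))"

definition fails_after :: "('q, 'a, 's) cspda \<Rightarrow> ('q, 's) config \<Rightarrow> 'a list \<Rightarrow> bool" where
  "fails_after M C w \<longleftrightarrow>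
     (\<exists>u v D. w = u @ v \<and> run M C u D \<and> (failing M D \<or> stuck M D v))"

text \<open>
  The bottom-of-stack, padding and top-of-stack symbols are \<^term>\<open>Bottom\<close>, \<^term>\<open>Padding\<close> and
  \<^term>\<open>Top\<close>. \<^term>\<open>Letter\<close> embeds the input alphabet into the stack alphabets, and
  \<^term>\<open>Aux\<close> supplies arbitrarily many further symbols.
\<close>

datatype 'a stack_symbol = Bottom | Padding | Top | Letter 'a | Aux nat

definition P1 :: "('q, 'a, 's) cspda \<Rightarrow> bool" where
  "P1 M \<longleftrightarrow> (\<forall>q \<in> states M. reading M q \<or> non_reading M q)"

definition P2 :: "('q, 'a, 's) cspda \<Rightarrow> bool" where
  "P2 M \<longleftrightarrow>
     (\<forall>q x d i\<^sub>1 q\<^sub>1 a\<^sub>1 i\<^sub>2 q\<^sub>2 a\<^sub>2.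
        (q, x, d, i\<^sub>1, q\<^sub>1, a\<^sub>1) \<in> second_transitions M \<longrightarrow>
        (q, x, d, i\<^sub>2, q\<^sub>2, a\<^sub>2) \<in> second_transitions M \<longrightarrow>
        i\<^sub>1 = i\<^sub>2 \<or> i\<^sub>1 = None \<or> i\<^sub>2 = None \<longrightarrow>
        i\<^sub>1 = i\<^sub>2 \<and> q\<^sub>1 = q\<^sub>2 \<and> a\<^sub>1 = a\<^sub>2)"

definition P3 :: "('q, 'a, 'a stack_symbol) cspda \<Rightarrow> bool" where
  "P3 M \<longleftrightarrow>
     {Bottom, Padding, Top} \<subseteq> check_alphabet M \<and>
     {Bottom, Padding} \<subseteq> pushdown_alphabet M \<and>
     (\<forall>q cs i q' cs' ps'.
        first_stage M q cs \<and> step M (q, cs, []) i (q', cs', ps') \<longrightarrow>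
          cs \<noteq> [] \<and> hd cs = Bottom \<and> last cs = Top \<and>
          Bottom \<notin> set (tl cs) \<and> Top \<notin> set (butlast cs) \<and>
          i = None \<and> ps' = [Bottom] \<and> reading M q') \<and>
     (\<forall>w q cs ps. reachable M w (q, cs, ps) \<longrightarrow> Bottom \<notin> set (butlast ps) \<and> Top \<notin> set ps) \<and>
     (\<forall>q d i q'. (q, Some Bottom, d, i, q', Pop) \<notin> second_transitions M) \<and>
     (\<forall>q x i q' y. (q, x, Some Top, i, q', Push y) \<notin> second_transitions M)"

definition P4 :: "('q, 'a, 's) cspda \<Rightarrow> bool" where
  "P4 M \<longleftrightarrow>
     \<not> (\<exists>(C :: nat \<Rightarrow> ('q, 's) config) w.
           reachable M w (C 0) \<and> (\<forall>n. step M (C n) None (C (Suc n))))"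

definition P5 :: "('q, 'a, 's) cspda \<Rightarrow> bool" where
  "P5 M \<longleftrightarrow> (\<forall>q \<in> accepting M. reading M q)"

definition P6 :: "('q, 'a, 's) cspda \<Rightarrow> bool" where
  "P6 M \<longleftrightarrow>
     (\<forall>C. \<forall>u \<in> lists (input_alphabet M). \<forall>v \<in> lists (input_alphabet M).
        entry_config M C \<and> v \<notin> language M \<longrightarrow>
          (\<exists>D. config_after M C u D \<and> config_after M C (u @ v) D) \<or> fails_after M C (u @ v))"

definition P7 :: "('q, 'a, 's) cspda \<Rightarrow> bool" where
  "P7 M \<longleftrightarrow> accepting M = {q \<in> states M. reading M q \<and> \<not> entry_state M q}"

definition special_cspda :: "('q, 'a, 'a stack_symbol) cspda \<Rightarrow> bool" where
  "special_cspda M \<longleftrightarrow>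
     is_cspda M \<and> P1 M \<and> P2 M \<and> P3 M \<and> P4 M \<and> P5 M \<and> P6 M \<and> P7 M"


section \<open>Special co-ET0L groups\<close>

definition inverse_closed_generating_set :: "('a, 'b) monoid_scheme \<Rightarrow> 'a set \<Rightarrow> bool" where
  "inverse_closed_generating_set G A \<longleftrightarrow>
     A \<subseteq> carrier G \<and> (\<forall>a \<in> A. inv\<^bsub>G\<^esub> a \<in> A) \<and> generate G A = carrier G"

definition coWP :: "('a, 'b) monoid_scheme \<Rightarrow> 'a set \<Rightarrow> 'a list set" where
  "coWP G A = {w \<in> lists A. foldr (\<otimes>\<^bsub>G\<^esub>) w \<one>\<^bsub>G\<^esub> \<noteq> \<one>\<^bsub>G\<^esub>}"

definition finitely_generated_group :: "('a, 'b) monoid_scheme \<Rightarrow> bool" where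
  "finitely_generated_group G \<longleftrightarrow>
     group G \<and> (\<exists>S. finite S \<and> S \<subseteq> carrier G \<and> generate G S = carrier G)"

text \<open>Since state sets are finite, it is no restriction to take natural numbers as states.\<close>

definition special_co_ET0L_group :: "('a, 'b) monoid_scheme \<Rightarrow> bool" where
  "special_co_ET0L_group G \<longleftrightarrow>
     finitely_generated_group G \<and>
     (\<exists>A (M :: (nat, 'a, 'a stack_symbol) cspda).
        finite A \<and> inverse_closed_generating_set G A \<and>
        special_cspda M \<and> input_alphabet M = A \<and>
        Letter ` A \<subseteq> check_alphabet M \<and> Letter ` A \<subseteq> pushdown_alphabet M \<and>
        language M = coWP G A)"

end

(*
Fix a free subgroup H of finite index and a transversal T. An element of G is uniquely h t with h in
H and t in T, so it can be stored as the reduced word of h on the pushdown stack (last letter on top)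
together with the state t; multiplying by a generator on the right changes h by a word of bounded
length. The machine performs these multiplications letter by letter and accepts unless it ends in the
configuration of the identity. The check stack is b p^n t and serves only as a guessed height bound: a
computation either jams at the top symbol or reaches a configuration that is determined by n and
the element read. Since the latter is the same for u and uv when v = 1, this gives (P6), and
a sufficiently large n never jams.
*)

theory Submission
  imports Defs
begin

section \<open>The machine\<close>

text \<open>\<open>Init\<close>, \<open>Fill\<close> and \<open>Full\<close> serve the first stage.
  In \<open>Multiply w t\<close> the word \<open>w\<close> has still to be multiplied onto the stack
  before the representative \<open>t\<close> is final. \<open>Entry\<close> doubles as the state of
  the identity, since acceptance depends on the state alone.\<close>

datatype 'a control = Init | Fill | Full | Entry | Settled 'a | Multiply "'a list" 'a

definition control_states :: "'a set \<Rightarrow> 'a set \<Rightarrow> nat \<Rightarrow> 'a control set" where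
  "control_states Y T K =
     {Init, Fill, Full, Entry} \<union> Settled ` T \<union>
     case_prod Multiply ` ({w. set w \<subseteq> Y \<and> length w \<le> K} \<times> T)"

lemma finite_control_states: "finite Y \<Longrightarrow> finite T \<Longrightarrow> finite (control_states Y T K)"
  by (auto simp: control_states_def intro!: finite_imageI finite_lists_length_le)

lemma control_states_iff [simp]:
  "Init \<in> control_states Y T K" "Fill \<in> control_states Y T K"
  "Full \<in> control_states Y T K" "Entry \<in> control_states Y T K"
  "Settled t \<in> control_states Y T K \<longleftrightarrow> t \<in> T"
  "Multiply w t \<in> control_states Y T K \<longleftrightarrow> set w \<subseteq> Y \<and> length w \<le> K \<and> t \<in> T"
  by (force simp: control_states_def)+

section \<open>Products of words and stacks\<close>

definition word_value :: "('a, 'b) monoid_scheme \<Rightarrow> 'a list \<Rightarrow> 'a" where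
  "word_value G w = foldr (\<otimes>\<^bsub>G\<^esub>) w \<one>\<^bsub>G\<^esub>"

text \<open>Stacks are listed from the top, and the top is the last letter of the normal form, hence
  the reversal.\<close>

definition stack_value :: "('a, 'b) monoid_scheme \<Rightarrow> 'a list \<Rightarrow> 'a" where
  "stack_value G r = word_value G (rev r)"

text \<open>Reducedness expressed with elements of \<open>G\<close> in place of free letters. On the
  carrier the relation between neighbours is symmetric, so a stack may be listed from either
  end.\<close>

definition inverse_free :: "('a, 'b) monoid_scheme \<Rightarrow> 'a list \<Rightarrow> bool" where
  "inverse_free G r \<longleftrightarrow> successively (\<lambda>x y. y \<noteq> inv\<^bsub>G\<^esub> x) r"

context group
begin

lemma word_value_Nil [simp]: "word_value G [] = \<one>"
  by (simp add: word_value_def)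

lemma word_value_Cons [simp]: "word_value G (x # w) = x \<otimes> word_value G w"
  by (simp add: word_value_def)

lemma word_value_closed [simp, intro]: "set w \<subseteq> carrier G \<Longrightarrow> word_value G w \<in> carrier G"
  by (induction w) auto

lemma word_value_append [simp]:
  "set v \<subseteq> carrier G \<Longrightarrow> set w \<subseteq> carrier G \<Longrightarrow>
     word_value G (v @ w) = word_value G v \<otimes> word_value G w"
  by (induction v) (auto simp: m_assoc)

lemma stack_value_Nil [simp]: "stack_value G [] = \<one>"
  by (simp add: stack_value_def)

lemma stack_value_closed [simp, intro]: "set r \<subseteq> carrier G \<Longrightarrow> stack_value G r \<in> carrier G"
  by (simp add: stack_value_def)

lemma stack_value_Cons [simp]:
  "x \<in> carrier G \<Longrightarrow> set r \<subseteq> carrier G \<Longrightarrow> stack_value G (x # r) = stack_value G r \<otimes> x"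
  by (simp add: stack_value_def)

end

lemma run_append: "run M C u D \<Longrightarrow> run M D v E \<Longrightarrow> run M C (u @ v) E"
  by (induction rule: run.induct) (auto intro: run.intros)

text \<open>
  After reading \<open>a\<close> in coset \<open>t\<close>, the machine multiplies the stack by \<^term>\<open>trail t a\<close> and moves
  to coset \<^term>\<open>rep t a\<close>. The set \<open>Y\<close> will consist of the basis elements that occur
  in some trail and their inverses, so that the basis itself need not be shown to be finite.
\<close>

locale normal_form_machine = group G for G :: "('a, 'b) monoid_scheme" (structure) +
  fixes A Y T :: "'a set"
    and trail :: "'a \<Rightarrow> 'a \<Rightarrow> 'a list"
    and rep :: "'a \<Rightarrow> 'a \<Rightarrow> 'a"
    and K :: nat
    and enc :: "'a control \<Rightarrow> nat"
  assumes finite_A: "finite A" and finite_Y: "finite Y" and finite_T: "finite T"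
    and A_closed: "A \<subseteq> carrier G" and Y_closed: "Y \<subseteq> carrier G" and T_closed: "T \<subseteq> carrier G"
    and Y_inv: "y \<in> Y \<Longrightarrow> inv y \<in> Y"
    and one_T: "\<one> \<in> T"
    and trail: "t \<in> T \<Longrightarrow> a \<in> A \<Longrightarrow> set (trail t a) \<subseteq> Y"
    and trail_length: "t \<in> T \<Longrightarrow> a \<in> A \<Longrightarrow> length (trail t a) \<le> K"
    and rep: "t \<in> T \<Longrightarrow> a \<in> A \<Longrightarrow> rep t a \<in> T"
    and trail_rep: "t \<in> T \<Longrightarrow> a \<in> A \<Longrightarrow> word_value G (trail t a) \<otimes> rep t a = t \<otimes> a"
    and normal_form_unique:
      "\<lbrakk>set r \<subseteq> Y; set s \<subseteq> Y; inverse_free G r; inverse_free G s; t \<in> T; t' \<in> T;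
        stack_value G r \<otimes> t = stack_value G s \<otimes> t'\<rbrakk> \<Longrightarrow> r = s \<and> t = t'"
    and inj_enc: "inj_on enc (control_states Y T K)"
begin

section \<open>Transitions of the machine\<close>

abbreviation Q :: "'a control set" where
  "Q \<equiv> control_states Y T K"

text \<open>Top symbols that can occur after entry. As \<open>None\<close> is missing,
  \<open>enter\<close> is the only transition from an empty pushdown stack.\<close>

definition tops :: "'a stack_symbol option set" where
  "tops = Some ` insert Bottom (Letter ` Y)"

text \<open>\<open>push\<close> is barred when the top symbol cancels \<open>y\<close>, which
  separates it from \<open>pop\<close> and keeps the stack reduced; after entry it is the only rule
  barred at \<open>Top\<close>. \<open>settle\<close> returns to \<open>Entry\<close> at the normal
  form of the identity, so that every \<open>Settled\<close> state may accept.\<close>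

inductive transition ::
  "'a control \<Rightarrow> 'a stack_symbol option \<Rightarrow> 'a stack_symbol option \<Rightarrow> 'a option \<Rightarrow>
   'a control \<Rightarrow> 'a stack_symbol action \<Rightarrow> bool" where
  enter: "transition Full None None None Entry (Push Bottom)"
| read_Entry: "a \<in> A \<Longrightarrow> x \<in> tops \<Longrightarrow> d \<in> Some ` {Bottom, Padding, Top} \<Longrightarrow>
    transition Entry x d (Some a) (Multiply (trail \<one> a) (rep \<one> a)) Stay"
| read_Settled: "a \<in> A \<Longrightarrow> t \<in> T \<Longrightarrow> x \<in> tops \<Longrightarrow> d \<in> Some ` {Bottom, Padding, Top} \<Longrightarrow>
    transition (Settled t) x d (Some a) (Multiply (trail t a) (rep t a)) Stay"
| push: "set (y # w) \<subseteq> Y \<Longrightarrow> length (y # w) \<le> K \<Longrightarrow> t \<in> T \<Longrightarrow>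
    x \<in> tops \<Longrightarrow> x \<noteq> Some (Letter (inv y)) \<Longrightarrow> d \<in> Some ` {Bottom, Padding} \<Longrightarrow>
    transition (Multiply (y # w) t) x d None (Multiply w t) (Push (Letter y))"
| pop: "set (y # w) \<subseteq> Y \<Longrightarrow> length (y # w) \<le> K \<Longrightarrow> t \<in> T \<Longrightarrow>
    d \<in> Some ` {Bottom, Padding, Top} \<Longrightarrow>
    transition (Multiply (y # w) t) (Some (Letter (inv y))) d None (Multiply w t) Pop"
| settle: "t \<in> T \<Longrightarrow> x \<in> tops \<Longrightarrow> d \<in> Some ` {Bottom, Padding, Top} \<Longrightarrow>
    transition (Multiply [] t) x d None
      (if t = \<one> \<and> x = Some Bottom then Entry else Settled t) Stay"

text \<open>The letters of \<open>A\<close> are put into both stack alphabets to meet the convention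
  in \<open>special_co_ET0L_group\<close>; the transitions write only \<open>Bottom\<close> and
  letters of \<open>Y\<close> on the pushdown stack.\<close>

definition M :: "(nat, 'a, 'a stack_symbol) cspda" where
  "M = \<lparr>states = enc ` Q, input_alphabet = A,
        check_alphabet = {Bottom, Padding, Top} \<union> Letter ` A,
        pushdown_alphabet = {Bottom, Padding} \<union> Letter ` (A \<union> Y),
        initial_state = enc Init, accepting = enc ` Settled ` T,
        first_transitions =
          {(enc Init, Bottom, enc Fill), (enc Fill, Padding, enc Fill), (enc Fill, Top, enc Full)},
        second_transitions =
          {(enc q, x, d, i, enc q', a) | q x d i q' a. transition q x d i q' a}\<rparr>"

lemma M_simps [simp]:
  "states M = enc ` Q" "input_alphabet M = A"
  "check_alphabet M = {Bottom, Padding, Top} \<union> Letter ` A"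
  "pushdown_alphabet M = {Bottom, Padding} \<union> Letter ` (A \<union> Y)"
  "initial_state M = enc Init" "accepting M = enc ` Settled ` T"
  "first_transitions M =
     {(enc Init, Bottom, enc Fill), (enc Fill, Padding, enc Fill), (enc Fill, Top, enc Full)}"
  by (simp_all add: M_def)

lemma enc_eq_iff [simp]: "q \<in> Q \<Longrightarrow> q' \<in> Q \<Longrightarrow> enc q = enc q' \<longleftrightarrow> q = q'"
  using inj_enc by (auto dest: inj_onD)

lemma transition_states: "transition q x d i q' a \<Longrightarrow> q \<in> Q \<and> q' \<in> Q"
  by (induction rule: transition.induct)
    (use one_T in \<open>auto simp: trail trail_length rep subsetD[OF trail]\<close>)

lemma second_transitions_enc_iff [simp]:
  assumes "q \<in> Q" "q' \<in> Q"
  shows "(enc q, x, d, i, enc q', a) \<in> second_transitions M \<longleftrightarrow> transition q x d i q' a"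
  using assms transition_states by (fastforce simp: M_def)

lemma second_transitionsE:
  assumes "(p, x, d, i, p', a) \<in> second_transitions M"
  obtains q q' where "p = enc q" "p' = enc q'" "q \<in> Q" "q' \<in> Q" "transition q x d i q' a"
  using assms transition_states by (fastforce simp: M_def)

lemma transition_alphabets:
  assumes "transition q x d i q' a"
  shows "set_option x \<subseteq> insert Bottom (Letter ` Y)" "set_option d \<subseteq> {Bottom, Padding, Top}"
    "set_option i \<subseteq> A" "set_action a \<subseteq> insert Bottom (Letter ` Y)"
  using assms Y_inv by (auto elim!: transition.cases simp: tops_def)

lemma is_cspda_M: "is_cspda M"
  unfolding is_cspda_def
proof (intro conjI ballI)
  fix e assume "e \<in> second_transitions M"
  then obtain q q' x d i a where "e = (enc q, x, d, i, enc q', a)" "q \<in> Q" "q' \<in> Q"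
    "transition q x d i q' a"
    by (cases e) (blast elim: second_transitionsE)
  moreover from this(4) have "set_option x \<subseteq> pushdown_alphabet M"
    "set_option d \<subseteq> check_alphabet M" "set_option i \<subseteq> input_alphabet M"
    "set_action a \<subseteq> pushdown_alphabet M"
    using transition_alphabets[of q x d i q' a] unfolding M_simps by blast+
  ultimately show "case e of (q, x, d, i, q', a) \<Rightarrow>
        q \<in> states M \<and> q' \<in> states M \<and>
        set_option x \<subseteq> pushdown_alphabet M \<and> set_option d \<subseteq> check_alphabet M \<and>
        set_option i \<subseteq> input_alphabet M \<and> set_action a \<subseteq> pushdown_alphabet M"
    by simp
qed (use finite_A finite_Y finite_T finite_control_states in auto)

section \<open>Reading states and determinism\<close>

lemma reading_enc:
  assumes "q \<in> Q"
  shows "reading M (enc q) \<longleftrightarrow>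
    q \<noteq> Init \<and> q \<noteq> Fill \<and> (\<nexists>x d q' a. transition q x d None q' a)"
proof -
  have 1: "(\<forall>d p. (enc q, d, p) \<notin> first_transitions M) \<longleftrightarrow> q \<noteq> Init \<and> q \<noteq> Fill"
    using assms by auto
  have 2: "(\<forall>x d i p a. (enc q, x, d, i, p, a) \<in> second_transitions M \<longrightarrow> i \<noteq> None) \<longleftrightarrow>
      (\<nexists>x d q' a. transition q x d None q' a)"
  proof
    assume *: "\<forall>x d i p a. (enc q, x, d, i, p, a) \<in> second_transitions M \<longrightarrow> i \<noteq> None"
    show "\<nexists>x d q' a. transition q x d None q' a"
    proof
      assume "\<exists>x d q' a. transition q x d None q' a"
      then obtain x d q' a where tr: "transition q x d None q' a" by blast
      then have "(enc q, x, d, None, enc q', a) \<in> second_transitions M"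
        using transition_states[OF tr] by simp
      with * show False by blast
    qed
  next
    assume *: "\<nexists>x d q' a. transition q x d None q' a"
    show "\<forall>x d i p a. (enc q, x, d, i, p, a) \<in> second_transitions M \<longrightarrow> i \<noteq> None"
    proof (intro allI impI)
      fix x d i p a assume "(enc q, x, d, i, p, a) \<in> second_transitions M"
      then obtain q\<^sub>1 q' where "enc q = enc q\<^sub>1" "q\<^sub>1 \<in> Q" "transition q\<^sub>1 x d i q' a"
        by (elim second_transitionsE) blast
      then have "transition q x d i q' a" using assms by simp
      with * show "i \<noteq> None" by metis
    qed
  qed
  show ?thesis unfolding reading_def 1 2 by blast
qed

lemma reading_iff:
  assumes "q \<in> Q"
  shows "reading M (enc q) \<longleftrightarrow> q = Entry \<or> q \<in> Settled ` T"
proof (cases q)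
  case Full
  then show ?thesis using enter by (auto simp: reading_enc)
next
  case Entry
  then show ?thesis by (auto simp: reading_enc elim: transition.cases)
next
  case (Settled t)
  then show ?thesis using assms by (auto simp: reading_enc elim: transition.cases)
next
  case (Multiply w t)
  \<comment> \<open>With \<open>Bottom\<close> on both stacks nothing can cancel, so
    \<open>settle\<close> or \<open>push\<close> is available as a silent transition.\<close>
  have "\<exists>q' a. transition q (Some Bottom) (Some Bottom) None q' a"
  proof (cases w)
    case Nil
    then show ?thesis
      using Multiply assms settle[of t "Some Bottom" "Some Bottom"] unfolding tops_def by auto
  next
    case (Cons y v)
    then show ?thesis
      using Multiply assms push[of y v t "Some Bottom" "Some Bottom"] unfolding tops_def by auto
  qed
  then show ?thesis
    using Multiply assms by (auto simp: reading_enc)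
qed (use assms in \<open>auto simp: reading_enc\<close>)

lemma P1_M: "P1 M"
  unfolding P1_def
proof
  fix p assume "p \<in> states M"
  then obtain q where q: "q \<in> Q" "p = enc q" by auto
  have "non_reading M (enc q)" if "q \<noteq> Entry" "q \<notin> Settled ` T"
    using that q by (auto simp: non_reading_def elim!: second_transitionsE elim: transition.cases)
  then show "reading M p \<or> non_reading M p"
    using q reading_iff by blast
qed

text \<open>The control fixes the rule, except that \<open>push\<close> and \<open>pop\<close> share
  one and are told apart by the top symbol; a silent and a reading rule never share a
  control.\<close>

lemma transition_deterministic:
  assumes "transition q x d i\<^sub>1 q\<^sub>1 a\<^sub>1" "transition q x d i\<^sub>2 q\<^sub>2 a\<^sub>2"
    and "i\<^sub>1 = i\<^sub>2 \<or> i\<^sub>1 = None \<or> i\<^sub>2 = None"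
  shows "i\<^sub>1 = i\<^sub>2 \<and> q\<^sub>1 = q\<^sub>2 \<and> a\<^sub>1 = a\<^sub>2"
  using assms by (auto elim!: transition.cases)

lemma P2_M: "P2 M"
  unfolding P2_def
proof (intro allI impI, goal_cases)
  case (1 q x d i\<^sub>1 q\<^sub>1 a\<^sub>1 i\<^sub>2 q\<^sub>2 a\<^sub>2)
  then obtain p p\<^sub>1 p' p\<^sub>2 where
    "q = enc p" "q\<^sub>1 = enc p\<^sub>1" "p \<in> Q" "transition p x d i\<^sub>1 p\<^sub>1 a\<^sub>1"
    "q = enc p'" "q\<^sub>2 = enc p\<^sub>2" "p' \<in> Q" "transition p' x d i\<^sub>2 p\<^sub>2 a\<^sub>2"
    by (elim second_transitionsE) blast
  with transition_deterministic[of p x d i\<^sub>1 p\<^sub>1 a\<^sub>1 i\<^sub>2 p\<^sub>2 a\<^sub>2] 1(3) show ?case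
    by auto
qed

lemma step_cases:
  assumes "step M (enc q, cs, ps) i C" "q \<in> Q"
  obtains q' a ps' where "q' \<in> Q" "C = (enc q', cs, ps')" "perform a ps ps'"
    "transition q (top_symbol ps) (symbol_at_height cs (length ps)) i q' a"
  using assms by (auto elim!: step.cases second_transitionsE)

lemma step_intro:
  assumes "transition q (top_symbol ps) (symbol_at_height cs (length ps)) i q' a"
    and "perform a ps ps'"
  shows "step M (enc q, cs, ps) i (enc q', cs, ps')"
  using assms transition_states[OF assms(1)] by (auto intro!: step.intros)


section \<open>Configurations\<close>

definition check_stack :: "nat \<Rightarrow> 'a stack_symbol list" where
  "check_stack n = Bottom # replicate n Padding @ [Top]"

definition pushdown_stack :: "'a list \<Rightarrow> 'a stack_symbol list" where
  "pushdown_stack r = map Letter r @ [Bottom]"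

definition config :: "nat \<Rightarrow> 'a control \<Rightarrow> 'a list \<Rightarrow> (nat, 'a stack_symbol) config" where
  "config n q r = (enc q, check_stack n, pushdown_stack r)"

lemma first_stage_cases:
  "first_stage M p cs \<Longrightarrow>
     (p = enc Init \<and> cs = []) \<or> (\<exists>n. p = enc Fill \<and> cs = Bottom # replicate n Padding) \<or>
     (\<exists>n. p = enc Full \<and> cs = check_stack n)"
proof (induction rule: first_stage.induct)
  case (push q cs d q')
  have *: "\<exists>m. replicate n Padding @ [Padding] = replicate m Padding" for n
    by (rule exI[of _ "Suc n"]) (simp add: replicate_append_same)
  from push show ?case
    by (auto simp: check_stack_def * intro: exI[of _ "0::nat"])
qed simp

lemma first_stage_Fill: "first_stage M (enc Fill) (Bottom # replicate n Padding)"
proof (induction n)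
  case 0
  show ?case using first_stage.push[OF first_stage.start, of M Bottom "enc Fill"] by simp
next
  case (Suc n)
  from first_stage.push[OF this, of Padding "enc Fill"] show ?case
    by (simp add: replicate_append_same)
qed

lemma first_stage_Full: "first_stage M (enc Full) (check_stack n)"
  using first_stage.push[OF first_stage_Fill, of Top "enc Full" n] by (simp add: check_stack_def)

text \<open>On an empty pushdown stack only \<open>enter\<close> applies, so the second stage can
  begin only in \<open>Full\<close>, once the check stack is complete.\<close>

lemma step_first_stage:
  assumes "first_stage M p cs" "step M (p, cs, []) i C"
  obtains n where "p = enc Full" "cs = check_stack n" "i = None" "C = config n Entry []"
proof -
  obtain q where q: "q \<in> Q" "p = enc q"
    using first_stage_cases[OF assms(1)] by auto
  from assms(2) have "step M (enc q, cs, []) i C" using q by simp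
  then obtain q' a ps' where *: "C = (enc q', cs, ps')" "perform a [] ps'"
    "transition q None None i q' a"
    using q by (elim step_cases) (auto simp: top_symbol_def symbol_at_height_def)
  from *(3) have "q = Full \<and> i = None \<and> q' = Entry \<and> a = Push Bottom"
    by cases (auto simp: tops_def)
  then show ?thesis
    using that first_stage_cases[OF assms(1)] q * 
    by (auto simp: config_def pushdown_stack_def elim: perform.cases)
qed

lemma step_Full: "step M (enc Full, check_stack n, []) None (config n Entry [])"
  unfolding config_def pushdown_stack_def
  by (rule step_intro[of _ _ _ _ _ "Push Bottom"])
    (auto simp: top_symbol_def symbol_at_height_def intro: enter perform.intros)

lemma entry_config_iff: "entry_config M C \<longleftrightarrow> (\<exists>n. C = config n Entry [])"
  unfolding entry_config_def
  using step_first_stage first_stage_Full step_Full by metis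

lemma config_eq_iff:
  assumes "q \<in> Q" "q' \<in> Q"
  shows "config n q r = config m q' s \<longleftrightarrow> n = m \<and> q = q' \<and> r = s"
proof -
  have "n = m" if "check_stack n = check_stack m"
    using arg_cong[OF that, of length] by (simp add: check_stack_def)
  moreover have "r = s" if "pushdown_stack r = pushdown_stack s"
    using that by (auto simp: pushdown_stack_def inj_map_eq_map inj_def)
  ultimately show ?thesis
    using assms by (auto simp: config_def)
qed

section \<open>The group element stored in a configuration\<close>

fun control_value :: "'a control \<Rightarrow> 'a" where
  "control_value (Settled t) = t"
| "control_value (Multiply w t) = word_value G w \<otimes> t"
| "control_value _ = \<one>"

fun pending :: "'a control \<Rightarrow> nat" where
  "pending (Multiply w t) = length w"
| "pending _ = 0"

definition config_value :: "'a control \<Rightarrow> 'a list \<Rightarrow> 'a" where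
  "config_value q r = stack_value G r \<otimes> control_value q"

text \<open>The invariant after entry. \<open>check_stack n\<close> has \<open>n + 2\<close> symbols
  and the pushdown stack has \<open>Bottom\<close> below \<open>r\<close>, hence the bound
  \<open>Suc n\<close>. The last two conditions separate \<open>Entry\<close> from
  \<open>Settled \<one>\<close>, which has the same control value.\<close>

definition valid :: "nat \<Rightarrow> 'a control \<Rightarrow> 'a list \<Rightarrow> bool" where
  "valid n q r \<longleftrightarrow> q \<in> Q - {Init, Fill, Full} \<and> set r \<subseteq> Y \<and> inverse_free G r \<and>
     length r \<le> Suc n \<and> (q = Entry \<longrightarrow> r = []) \<and> (q = Settled \<one> \<longrightarrow> r \<noteq> [])"

lemma valid_Entry: "valid n Entry []"
  by (simp add: valid_def inverse_free_def)

lemma top_symbol_pushdown_stack [simp]: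
  "top_symbol (pushdown_stack []) = Some Bottom"
  "top_symbol (pushdown_stack (y # r)) = Some (Letter y)"
  by (simp_all add: top_symbol_def pushdown_stack_def)

lemma top_symbol_tops: "set r \<subseteq> Y \<Longrightarrow> top_symbol (pushdown_stack r) \<in> tops"
  by (cases r) (auto simp: tops_def)

lemma symbol_at_head:
  assumes "length r \<le> Suc n"
  shows "symbol_at_height (check_stack n) (length (pushdown_stack r)) =
    Some (if r = [] then Bottom else if length r \<le> n then Padding else Top)"
  using assms
  by (auto simp: symbol_at_height_def check_stack_def pushdown_stack_def nth_Cons nth_append
      split: nat.split)

lemma control_value_closed: "q \<in> Q \<Longrightarrow> control_value q \<in> carrier G"
  using T_closed Y_closed by (cases q) (auto intro!: m_closed word_value_closed)

lemma config_value_closed: "valid n q r \<Longrightarrow> config_value q r \<in> carrier G"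
  using Y_closed control_value_closed by (auto simp: valid_def config_value_def)

text \<open>Silent steps at most shift a letter from the control to the stack or cancel it there, so
  the product is unchanged. By \<open>trail_rep\<close> a reading step multiplies it by the letter
  read, and it adds at most \<open>K\<close> pending letters.\<close>

lemma step_valid:
  assumes "step M (config n q r) i C" "valid n q r"
  obtains q' r' where "C = config n q' r'" "valid n q' r'" "set_option i \<subseteq> A"
    "config_value q' r' = config_value q r \<otimes> word_value G (case i of None \<Rightarrow> [] | Some a \<Rightarrow> [a])"
    "length r' + pending q' \<le> length r + pending q + (case i of None \<Rightarrow> 0 | Some a \<Rightarrow> K)"
proof -
  have q: "q \<in> Q" and rY: "set r \<subseteq> Y" and len: "length r \<le> Suc n"
    using assms(2) by (auto simp: valid_def)
  have rG: "set r \<subseteq> carrier G" using rY Y_closed by blast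
  obtain q' a ps' where C: "C = (enc q', check_stack n, ps')" "perform a (pushdown_stack r) ps'"
    and tr: "transition q (top_symbol (pushdown_stack r))
      (Some (if r = [] then Bottom else if length r \<le> n then Padding else Top)) i q' a"
    using assms(1) q symbol_at_head[OF len] unfolding config_def by (elim step_cases) auto
  have q': "q' \<in> Q" using transition_states[OF tr] by simp
  have top: "top_symbol (pushdown_stack r) = Some Bottom \<longleftrightarrow> r = []"
    by (cases r) auto
  have stay: "ps' = pushdown_stack r" if "a = Stay"
    using C that by (auto elim: perform.cases)
  from tr show ?thesis
  proof cases
    case (read_Entry b)
    then have b: "b \<in> carrier G" using A_closed by auto
    show ?thesis
      using that[of q' r] read_Entry stay C assms(2) q' one_T b
      by (auto simp: config_def valid_def config_value_def trail_length trail_rep)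
  next
    case (read_Settled b t)
    then have b: "b \<in> carrier G" "t \<in> carrier G" using A_closed T_closed by auto
    show ?thesis
      using that[of q' r] read_Settled stay C assms(2) q' b rG
      by (auto simp: config_def valid_def config_value_def trail_length trail_rep m_assoc)
  next
    case (push y w t)
    then have mem: "y \<in> carrier G" "set w \<subseteq> carrier G" "t \<in> carrier G" "y \<in> Y"
      using Y_closed T_closed by auto
    \<comment> \<open>A push requires a check stack symbol other than \<open>Top\<close> at the
      head, which leaves room for one more letter.\<close>
    have "length r \<le> n" using \<open>_ \<in> Some ` {Bottom, Padding}\<close> len by (auto split: if_splits)
    moreover have "inverse_free G (y # r)"
      using assms(2) \<open>_ \<noteq> Some (Letter (inv y))\<close>
      by (cases r) (auto simp: valid_def inverse_free_def)
    moreover have "ps' = pushdown_stack (y # r)"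
      using C push by (auto simp: pushdown_stack_def elim: perform.cases)
    ultimately show ?thesis
      using that[of q' "y # r"] push C assms(2) q' mem rG
      by (auto simp: config_def valid_def config_value_def m_assoc)
  next
    case (pop y w t)
    then have mem: "y \<in> carrier G" "set w \<subseteq> carrier G" "t \<in> carrier G" "y \<in> Y"
      using Y_closed T_closed by auto
    obtain s where s: "r = inv y # s"
      using \<open>top_symbol _ = _\<close> by (cases r) auto
    have "ps' = pushdown_stack s"
      using C pop s by (auto simp: pushdown_stack_def elim: perform.cases)
    moreover have "inverse_free G s"
      using assms(2) s by (cases s) (auto simp: valid_def inverse_free_def)
    moreover have "stack_value G s \<otimes> (word_value G w \<otimes> t) =
      stack_value G s \<otimes> inv y \<otimes> (y \<otimes> word_value G w \<otimes> t)"
      using mem rG s by (simp add: m_assoc inv_solve_left' flip: m_assoc[of "inv y"])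
    ultimately show ?thesis
      using that[of q' s] pop C assms(2) q' mem rG s
      by (auto simp: config_def valid_def config_value_def)
  next
    case (settle t)
    then have t: "t \<in> carrier G" using T_closed by auto
    \<comment> \<open>The top symbol is \<open>Bottom\<close> exactly for \<open>r = []\<close>, so
      \<open>Settled \<one>\<close> never arises over an empty stack.\<close>
    have q'_eq: "q' = (if t = \<one> \<and> r = [] then Entry else Settled t)"
      using settle(3) by (simp add: top)
    then have "valid n q' r"
      using assms(2) q' by (auto simp: valid_def)
    moreover have "config_value q' r = config_value q r"
      using q'_eq settle(1) t rG by (auto simp: config_value_def)
    moreover have "pending q' = 0"
      using q'_eq by simp
    moreover have "C = config n q' r"
      using C(1) settle stay by (simp add: config_def)
    ultimately show ?thesis
      using that[of q' r] settle(2) config_value_closed[OF assms(2)] by simp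
  qed
qed

text \<open>Iterates \<open>step_valid\<close>. The bound on stack and pending letters does not
  involve \<open>n\<close>, which is what lets a high check stack avoid jams.\<close>

lemma run_valid:
  assumes "run M C w D" "C = config n q r" "valid n q r"
  obtains q' r' where "D = config n q' r'" "valid n q' r'" "set w \<subseteq> A"
    "config_value q' r' = config_value q r \<otimes> word_value G w"
    "length r' + pending q' \<le> length r + pending q + K * length w"
  using assms
proof (induction arbitrary: q r thesis rule: run.induct)
  case (run_refl C)
  then show ?case using config_value_closed by simp
next
  case (run_silent C C' w D)
  from run_silent.hyps(1) run_silent.prems obtain q\<^sub>1 r\<^sub>1 where 1: "C' = config n q\<^sub>1 r\<^sub>1" "valid n q\<^sub>1 r\<^sub>1"
    "config_value q\<^sub>1 r\<^sub>1 = config_value q r" "length r\<^sub>1 + pending q\<^sub>1 \<le> length r + pending q"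
    by (auto elim!: step_valid simp: config_value_closed)
  from run_silent.IH[OF _ 1(1,2)] obtain q' r' where "D = config n q' r'" "valid n q' r'" "set w \<subseteq> A"
    "config_value q' r' = config_value q\<^sub>1 r\<^sub>1 \<otimes> word_value G w"
    "length r' + pending q' \<le> length r\<^sub>1 + pending q\<^sub>1 + K * length w"
    by blast
  with 1 run_silent.prems(1)[of q' r'] show ?case by simp
next
  case (run_read C a C' w D)
  from run_read.hyps(1) run_read.prems obtain q\<^sub>1 r\<^sub>1 where 1: "C' = config n q\<^sub>1 r\<^sub>1" "valid n q\<^sub>1 r\<^sub>1"
    "a \<in> A" "config_value q\<^sub>1 r\<^sub>1 = config_value q r \<otimes> word_value G [a]"
    "length r\<^sub>1 + pending q\<^sub>1 \<le> length r + pending q + K"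
    by (auto elim!: step_valid)
  from run_read.IH[OF _ 1(1,2)] obtain q' r' where 2: "D = config n q' r'" "valid n q' r'" "set w \<subseteq> A"
    "config_value q' r' = config_value q\<^sub>1 r\<^sub>1 \<otimes> word_value G w"
    "length r' + pending q' \<le> length r\<^sub>1 + pending q\<^sub>1 + K * length w"
    by blast
  have "set w \<subseteq> carrier G" "a \<in> carrier G" using 1 2 A_closed by auto
  then have "config_value q' r' = config_value q r \<otimes> word_value G (a # w)"
    using 1 2 config_value_closed[OF run_read.prems(3)] by (simp add: m_assoc)
  with 1 2 run_read.prems(1)[of q' r'] show ?case by simp
qed

lemma run_config_value:
  assumes "run M (config n q r) w (config n q' r')" "valid n q r" "valid n q' r'"
  shows "config_value q' r' = config_value q r \<otimes> word_value G w"
    and "length r' + pending q' \<le> length r + pending q + K * length w"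
proof -
  have q': "q' \<in> Q" using assms(3) by (simp add: valid_def)
  obtain p s where 1: "config n q' r' = config n p s" and "valid n p s"
    and 2: "config_value p s = config_value q r \<otimes> word_value G w"
      "length s + pending p \<le> length r + pending q + K * length w"
    using run_valid[OF assms(1) refl assms(2)] by metis
  then have "p \<in> Q" by (simp add: valid_def)
  with 1 q' have "p = q'" "s = r'" by (simp_all add: config_eq_iff)
  with 2 show "config_value q' r' = config_value q r \<otimes> word_value G w"
    and "length r' + pending q' \<le> length r + pending q + K * length w"
    by simp_all
qed

section \<open>Silent computations: termination and jams\<close>

fun silent_bound :: "'a control \<Rightarrow> nat" where
  "silent_bound Full = 1"
| "silent_bound (Multiply w t) = Suc (length w)"
| "silent_bound _ = 0"

text \<open>\<open>push\<close> and \<open>pop\<close> each use up a pending letter; the extra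
  \<open>Suc\<close> in the measure pays for \<open>settle\<close>, and the value 1 at
  \<open>Full\<close> for \<open>enter\<close>.\<close>

lemma step_silent_bound:
  assumes "step M (enc q, cs, ps) None (enc q', cs', ps')" "q \<in> Q" "q' \<in> Q"
  shows "silent_bound q' < silent_bound q"
proof -
  from assms obtain x d a where "transition q x d None q' a"
    by (auto elim: step_cases)
  then show ?thesis by cases auto
qed

lemma P4_M: "P4 M"
  unfolding P4_def
proof clarify
  fix C :: "nat \<Rightarrow> (nat, 'a stack_symbol) config"
  assume C: "\<forall>n. step M (C n) None (C (Suc n))"
  define b where "b n = silent_bound (inv_into Q enc (fst (C n)))" for n
  have "b (Suc n) < b n" for n
  proof -
    from C have "step M (C n) None (C (Suc n))" by blast
    then obtain q q' cs ps ps' where "C n = (enc q, cs, ps)" "C (Suc n) = (enc q', cs, ps')"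
      "q \<in> Q" "q' \<in> Q"
      by (auto elim!: step.cases second_transitionsE)
    with step_silent_bound[of q cs ps q' cs ps'] C inj_enc show ?thesis
      by (metis b_def fst_conv inv_into_f_f)
  qed
  then have "b n + n \<le> b 0" for n
    by (induction n) (auto, metis Suc_leI add_Suc_right add_le_mono1 le_trans add_Suc)
  from this[of "Suc (b 0)"] show False by simp
qed

text \<open>The inequality records the cost of a jam, for a large \<open>n\<close> to contradict;
  excluding every step makes a jam a failure in the sense of \<open>stuck\<close>.\<close>

definition jammed :: "nat \<Rightarrow> 'a control \<Rightarrow> 'a list \<Rightarrow> bool" where
  "jammed n q r \<longleftrightarrow> \<not> reading M (enc q) \<and> (\<nexists>i C. step M (config n q r) i C) \<and>
     n < length r + pending q"

text \<open>The sole obstacle is a push at \<open>Top\<close>, where \<open>length r = Suc n\<close>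
  already exceeds \<open>n\<close>.\<close>

lemma silent_step_or_jammed:
  assumes "valid n q r" "\<not> reading M (enc q)"
  shows "(\<exists>C. step M (config n q r) None C) \<or> jammed n q r"
proof -
  have q: "q \<in> Q" and rY: "set r \<subseteq> Y" and len: "length r \<le> Suc n"
    using assms(1) by (auto simp: valid_def)
  note top = top_symbol_tops[OF rY]
  note head = symbol_at_head[OF len]
  have "q \<notin> {Init, Fill, Full}" using assms(1) by (simp add: valid_def)
  then obtain w t where w: "q = Multiply w t" "set w \<subseteq> Y" "length w \<le> K" "t \<in> T"
    using assms(2) q reading_iff[OF q] by (cases q) auto
  show ?thesis
  proof (cases w)
    case Nil
    have "step M (config n q r) None
      (enc (if t = \<one> \<and> top_symbol (pushdown_stack r) = Some Bottom then Entry else Settled t),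
       check_stack n, pushdown_stack r)"
      unfolding config_def w Nil
      by (rule step_intro[OF settle perform.intros(3)]) (use w top head in auto)
    then show ?thesis by blast
  next
    case (Cons y v)
    show ?thesis
    proof (cases "top_symbol (pushdown_stack r) = Some (Letter (inv y))")
      case True
      then obtain s where s: "r = inv y # s" by (cases r) auto
      have "step M (config n q r) None (enc (Multiply v t), check_stack n, pushdown_stack s)"
        unfolding config_def w Cons
      proof (rule step_intro)
        show "perform Pop (pushdown_stack r) (pushdown_stack s)"
          by (simp add: s pushdown_stack_def perform.intros)
      qed (unfold True, use w Cons head in \<open>auto intro!: pop\<close>)
      then show ?thesis by blast
    next
      case False
      show ?thesis
      proof (cases "length r \<le> n")
        case True
        have "step M (config n q r) None
          (enc (Multiply v t), check_stack n, Letter y # pushdown_stack r)"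
          unfolding config_def w Cons
          by (rule step_intro[OF push perform.intros(1)]) (use w Cons head top False True in auto)
        then show ?thesis by blast
      next
        case high: False
        then have at_top: "symbol_at_height (check_stack n) (length (pushdown_stack r)) = Some Top"
          using head by auto
        \<comment> \<open>The nonempty pending word excludes \<open>settle\<close>, the top symbol
          excludes \<open>pop\<close>, and \<open>Top\<close> excludes \<open>push\<close>.\<close>
        have "\<not> step M (config n q r) i C" for i C
        proof
          assume "step M (config n q r) i C"
          then obtain q' a where "transition q (top_symbol (pushdown_stack r)) (Some Top) i q' a"
            unfolding config_def using q by (elim step_cases) (auto simp: at_top)
          then show False by cases (use w Cons False in auto)
        qed
        then show ?thesis
          using assms(2) high w Cons by (auto simp: jammed_def)
      qed
    qed
  qed
qed

lemma silent_run:
  assumes "valid n q r"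
  shows "\<exists>q' r'. run M (config n q r) [] (config n q' r') \<and> valid n q' r' \<and>
    (reading M (enc q') \<or> jammed n q' r')"
  using assms
proof (induction "silent_bound q" arbitrary: q r rule: less_induct)
  case less
  show ?case
  proof (cases "reading M (enc q) \<or> jammed n q r")
    case True
    then show ?thesis using less.prems run_refl by blast
  next
    case False
    then obtain C where C: "step M (config n q r) None C"
      using silent_step_or_jammed less.prems by blast
    then obtain q\<^sub>1 r\<^sub>1 where 1: "C = config n q\<^sub>1 r\<^sub>1" "valid n q\<^sub>1 r\<^sub>1"
      using less.prems by (elim step_valid)
    then have "silent_bound q\<^sub>1 < silent_bound q"
      using C less.prems unfolding config_def valid_def by (blast intro: step_silent_bound)
    from less.hyps[OF this 1(2)] show ?thesis
      using C 1(1) run_silent by metis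
  qed
qed

text \<open>Reading leaves the stack alone and is allowed at every head symbol, \<open>Top\<close>
  included, so jams arise only in silent phases.\<close>

lemma read_step:
  assumes "valid n q r" "reading M (enc q)" "a \<in> A"
  shows "\<exists>C. step M (config n q r) (Some a) C"
proof -
  have q: "q \<in> Q" and rY: "set r \<subseteq> Y" and len: "length r \<le> Suc n"
    using assms(1) by (auto simp: valid_def)
  have "\<exists>q'. transition q (top_symbol (pushdown_stack r))
    (symbol_at_height (check_stack n) (length (pushdown_stack r))) (Some a) q' Stay"
  proof -
    have "symbol_at_height (check_stack n) (length (pushdown_stack r)) \<in> Some ` {Bottom, Padding, Top}"
      using symbol_at_head[OF len] by auto
    moreover have "q = Entry \<or> q \<in> Settled ` T"
      using assms(2) reading_iff[OF q] by simp
    ultimately show ?thesis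
      using assms(3) top_symbol_tops[OF rY] by (elim disjE imageE) (blast intro: read_Entry read_Settled)+
  qed
  then show ?thesis
    unfolding config_def by (blast intro: step_intro perform.intros)
qed

text \<open>Silent runs and reading steps alternate until the input ends or a jam occurs;
  \<open>v\<close> is the input then left unread.\<close>

lemma run_or_jammed:
  assumes "valid n q r" "set w \<subseteq> A"
  obtains u v q' r' where "w = u @ v" "run M (config n q r) u (config n q' r')" "valid n q' r'"
    "v = [] \<and> reading M (enc q') \<or> jammed n q' r'"
  using assms
proof (induction w arbitrary: q r thesis)
  case Nil
  then show ?case using silent_run[of n q r] by force
next
  case (Cons a w)
  obtain q\<^sub>1 r\<^sub>1 where 1: "run M (config n q r) [] (config n q\<^sub>1 r\<^sub>1)" "valid n q\<^sub>1 r\<^sub>1"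
    "reading M (enc q\<^sub>1) \<or> jammed n q\<^sub>1 r\<^sub>1"
    using silent_run Cons.prems by blast
  show ?case
  proof (cases "jammed n q\<^sub>1 r\<^sub>1")
    case True
    then show ?thesis using 1 Cons.prems(1)[of "[]" "a # w"] by simp
  next
    case False
    then obtain C where C: "step M (config n q\<^sub>1 r\<^sub>1) (Some a) C"
      using 1 read_step Cons.prems by fastforce
    then obtain q\<^sub>2 r\<^sub>2 where 2: "C = config n q\<^sub>2 r\<^sub>2" "valid n q\<^sub>2 r\<^sub>2"
      using 1(2) by (elim step_valid)
    from Cons.IH[OF _ 2(2)] Cons.prems(3) obtain u v q' r' where 3: "w = u @ v"
      "run M (config n q\<^sub>2 r\<^sub>2) u (config n q' r')" "valid n q' r'"
      "v = [] \<and> reading M (enc q') \<or> jammed n q' r'"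
      by (metis insert_subset list.simps(15))
    have "run M (config n q r) (a # u) (config n q' r')"
      using run_append[OF 1(1) run_read[OF C]] 2(1) 3(2) by simp
    then show ?thesis using 3 Cons.prems(1)[of "a # u" v] by simp
  qed
qed

text \<open>\<open>normal_form_unique\<close> recovers the stack and the representative. Only
  \<open>Entry\<close> and \<open>Settled \<one>\<close> could still be confused, and
  \<open>valid\<close> separates them by whether the stack is empty.\<close>

lemma config_determined:
  assumes "valid n q r" "reading M (enc q)" "valid n q' r'" "reading M (enc q')"
    and "config_value q r = config_value q' r'"
  shows "config n q r = config n q' r'"
proof -
  have *: "(p = Entry \<or> p \<in> Settled ` T) \<and> control_value p \<in> T"
    if "valid n p s" "reading M (enc p)" for p s
    using that reading_iff[of p] one_T by (auto simp: valid_def)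
  have "r = r'" "control_value q = control_value q'"
    using normal_form_unique[of r r' "control_value q" "control_value q'"] assms *
    by (auto simp: valid_def config_value_def)
  moreover from this have "q = q'"
    using *[OF assms(1,2)] *[OF assms(3,4)] assms(1,3) by (auto simp: valid_def)
  ultimately show ?thesis by simp
qed

text \<open>At a jam nothing can be read and the state is not reading, so even \<open>w = []\<close>
  counts as stuck.\<close>

lemma jammed_stuck: "jammed n q r \<Longrightarrow> stuck M (config n q r) w"
  by (auto simp: jammed_def stuck_def config_def split: list.split)


section \<open>The machine is special\<close>

lemma reachable_cases:
  assumes "reachable M w D"
  obtains (initial) p cs where "first_stage M p cs" "D = (p, cs, [])" "w = []"
  | (entered) n q r where "D = config n q r" "valid n q r" "set w \<subseteq> A"
      "config_value q r = word_value G w"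
proof -
  obtain p cs where p: "first_stage M p cs" "run M (p, cs, []) w D"
    using assms by (auto simp: reachable_def)
  have *: thesis if "run M (config n Entry []) w D" for n
    using run_valid[OF that refl valid_Entry] entered A_closed
    by (fastforce simp: config_value_def)
  from p(2) show thesis
  proof cases
    case run_refl
    then show ?thesis using initial p by blast
  next
    case (run_silent C)
    then show ?thesis using step_first_stage[OF p(1) run_silent(1)] * by metis
  next
    case (run_read a C v)
    then show ?thesis using step_first_stage[OF p(1)] by blast
  qed
qed

lemma reachable_config:
  "run M (config n Entry []) w D \<Longrightarrow> reachable M w D"
  unfolding reachable_def using first_stage_Full step_Full run_silent by metis

lemma P3_M: "P3 M"
  unfolding P3_def
proof (intro conjI)
  show "\<forall>q cs i q' cs' ps'. first_stage M q cs \<and> step M (q, cs, []) i (q', cs', ps') \<longrightarrow>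
      cs \<noteq> [] \<and> hd cs = Bottom \<and> last cs = Top \<and>
      Bottom \<notin> set (tl cs) \<and> Top \<notin> set (butlast cs) \<and>
      i = None \<and> ps' = [Bottom] \<and> reading M q'"
    by (auto elim!: step_first_stage
        simp: check_stack_def config_def pushdown_stack_def reading_iff butlast_append)
  show "\<forall>w q cs ps. reachable M w (q, cs, ps) \<longrightarrow> Bottom \<notin> set (butlast ps) \<and> Top \<notin> set ps"
    by (auto elim!: reachable_cases simp: config_def pushdown_stack_def)
  show "\<forall>q d i q'. (q, Some Bottom, d, i, q', Pop) \<notin> second_transitions M"
    by (auto elim!: second_transitionsE elim: transition.cases)
  show "\<forall>q x i q' y. (q, x, Some Top, i, q', Push y) \<notin> second_transitions M"
    by (auto elim!: second_transitionsE elim: transition.cases)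
qed auto

lemma P5_M: "P5 M"
  by (auto simp: P5_def reading_iff)

lemma P7_M: "P7 M"
proof -
  have "entry_state M (enc q) \<longleftrightarrow> q = Entry" if "q \<in> Q" for q
    using that by (auto simp: entry_state_def entry_config_iff config_def)
  then show ?thesis
    by (auto simp: P7_def reading_iff)
qed

text \<open>A word of value \<open>\<one>\<close> cannot lead to a \<open>Settled\<close> state,
  since \<open>config_determined\<close> would make the configuration the entry one. A word of
  another value cannot end in \<open>Entry\<close>, and a high check stack lets it be read
  completely.\<close>

lemma language_M: "language M = coWP G A"
proof (intro equalityI subsetI)
  fix w assume "w \<in> language M"
  then have "w \<in> lists A" and "\<exists>D. reachable M w D \<and> fst D \<in> enc ` Settled ` T"
    by (simp_all add: language_def del: in_lists_conv_set)
  then obtain D where D: "set w \<subseteq> A" "reachable M w D" "fst D \<in> enc ` Settled ` T"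
    unfolding lists_eq_set by blast
  from D(2) have "word_value G w \<noteq> \<one>"
  proof (cases rule: reachable_cases)
    case (initial p cs)
    then show ?thesis using D(3) first_stage_cases[of p cs] by auto
  next
    case (entered n q r)
    then obtain t where t: "q = Settled t" "t \<in> T"
      using D(3) by (auto simp: config_def valid_def)
    show ?thesis
    proof
      assume "word_value G w = \<one>"
      then have "config_value q r = config_value Entry []"
        using entered by (simp add: config_value_def)
      from config_determined[OF entered(2) _ valid_Entry _ this] t show False
        by (simp add: config_def reading_iff)
    qed
  qed
  with D(1) show "w \<in> coWP G A"
    by (auto simp: coWP_def word_value_def)
next
  fix w assume "w \<in> coWP G A"
  then have w: "set w \<subseteq> A" "word_value G w \<noteq> \<one>"
    by (auto simp: coWP_def word_value_def)
  \<comment> \<open>Each input letter adds at most \<open>K\<close> pending letters, so at this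
    height the inequality in \<open>jammed\<close> fails.\<close>
  define n where "n = K * length w"
  obtain u v q r where run: "w = u @ v" "run M (config n Entry []) u (config n q r)" "valid n q r"
    and halted: "v = [] \<and> reading M (enc q) \<or> jammed n q r"
    using run_or_jammed[OF valid_Entry w(1)] by blast
  have value_pending: "config_value q r = word_value G u" "length r + pending q \<le> K * length u"
    using run_config_value[OF run(2) valid_Entry run(3)] run(1) w(1) A_closed
    by (auto simp: config_value_def word_value_closed)
  then have "length r + pending q \<le> n"
    using run(1) by (simp add: n_def algebra_simps)
  with halted have v: "v = []" "reading M (enc q)"
    by (auto simp: jammed_def)
  have "q \<noteq> Entry"
    using run(1,3) value_pending(1) v w(2) by (auto simp: valid_def config_value_def)
  then have "fst (config n q r) \<in> accepting M"
    using v run(3) reading_iff[of q] by (auto simp: config_def valid_def)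
  moreover have "reachable M w (config n q r)"
    using run v reachable_config by simp
  ultimately show "w \<in> language M"
    using w(1) unfolding language_def M_simps lists_eq_set by blast
qed

lemma P6_M: "P6 M"
  unfolding P6_def
proof (intro allI ballI impI)
  fix C u v
  assume uv: "u \<in> lists (input_alphabet M)" "v \<in> lists (input_alphabet M)"
    and "entry_config M C \<and> v \<notin> language M"
  then obtain n where C: "C = config n Entry []" and v: "word_value G v = \<one>"
    by (auto simp: entry_config_iff language_M coWP_def word_value_def)
  have A: "set u \<subseteq> A" "set v \<subseteq> A" using uv by auto
  obtain u\<^sub>1 u\<^sub>2 q r where 1: "u = u\<^sub>1 @ u\<^sub>2" "run M C u\<^sub>1 (config n q r)" "valid n q r"
    "u\<^sub>2 = [] \<and> reading M (enc q) \<or> jammed n q r"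
    using run_or_jammed[OF valid_Entry A(1)] C by blast
  show "(\<exists>D. config_after M C u D \<and> config_after M C (u @ v) D) \<or> fails_after M C (u @ v)"
  proof (cases "jammed n q r")
    case True
    then show ?thesis
      using 1 jammed_stuck unfolding fails_after_def by (metis append.assoc)
  next
    case False
    obtain v\<^sub>1 v\<^sub>2 q' r' where 2: "v = v\<^sub>1 @ v\<^sub>2" "run M (config n q r) v\<^sub>1 (config n q' r')"
      "valid n q' r'" "v\<^sub>2 = [] \<and> reading M (enc q') \<or> jammed n q' r'"
      using run_or_jammed[OF 1(3) A(2)] by blast
    have run: "run M C (u @ v\<^sub>1) (config n q' r')"
      using 1 2 False run_append by fastforce
    show ?thesis
    proof (cases "jammed n q' r'")
      case True
      then show ?thesis
        using 2 run jammed_stuck unfolding fails_after_def by (metis append.assoc)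
    next
      case not_jammed: False
      \<comment> \<open>By \<open>language_M\<close> the word \<open>v\<close> has value
        \<open>\<one>\<close>. Both configurations thus have the same value over the same check
        stack, and \<open>config_determined\<close> applies.\<close>
      have "config_value q' r' = config_value q r"
        using run_config_value[OF 2(2) 1(3) 2(3)] 2 not_jammed v config_value_closed[OF 1(3)]
        by auto
      then have "config n q' r' = config n q r"
        using config_determined 1 2 False not_jammed by metis
      then have "config_after M C u (config n q r)" "config_after M C (u @ v) (config n q r)"
        using 1 2 False not_jammed run by (auto simp: config_after_def config_def)
      then show ?thesis by blast
    qed
  qed
qed

lemma special_cspda_M: "special_cspda M"
  by (simp add: special_cspda_def is_cspda_M P1_M P2_M P3_M P4_M P5_M P6_M P7_M)

end

section \<open>Normal forms in virtually free groups\<close>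

lemma reduced_word_iff: "reduced_word w \<longleftrightarrow> successively (\<lambda>l m. m \<noteq> inv_letter l) w"
  by (simp add: reduced_word_def successively_conv_nth)

text \<open>\<open>inv_letter\<close> is an involution, so the relation between neighbours is
  symmetric. Stacks list their words in reverse, which is where this is used.\<close>

lemma reduced_word_rev: "reduced_word (rev w) \<longleftrightarrow> reduced_word w"
  unfolding reduced_word_iff successively_rev
  by (rule successively_cong) (metis inv_letter_inv_letter, simp)

text \<open>Putting a letter before a word without cancellation is multiplication in
  \<open>free_group X\<close>; a reduced word is therefore the product of its letters.\<close>

lemma (in group) iso_free_group_word_value:
  assumes H: "subgroup H G" and \<phi>: "\<phi> \<in> iso (free_group X) (G\<lparr>carrier := H\<rparr>)"
  shows "w \<in> lists (X \<times> UNIV) \<Longrightarrow> reduced_word w \<Longrightarrow>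
    \<phi> w = word_value G (map (\<lambda>l. \<phi> [l]) w)"
proof (induction w)
  case Nil
  have "\<phi> \<one>\<^bsub>free_group X\<^esub> = \<one>\<^bsub>G\<lparr>carrier := H\<rparr>\<^esub>"
    using \<phi> by (intro hom_one group_free_group subgroup_imp_group H) (simp add: iso_def)
  then show ?case by (simp add: free_group_def)
next
  case (Cons l w)
  then have "reduced_word w" by (blast dest: reduced_word_tl)
  moreover have "\<phi> ([l] \<otimes>\<^bsub>free_group X\<^esub> w) = \<phi> [l] \<otimes>\<^bsub>G\<lparr>carrier := H\<rparr>\<^esub> \<phi> w"
    using \<phi> Cons.prems \<open>reduced_word w\<close>
    by (intro hom_mult) (auto simp: iso_def free_group_def)
  ultimately show ?case
    using Cons by (simp add: free_group_def cons_reduce_reduced)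
qed

lemma (in group) iso_free_group_inv_letter:
  assumes H: "subgroup H G" and \<phi>: "\<phi> \<in> iso (free_group X) (G\<lparr>carrier := H\<rparr>)"
    and l: "l \<in> X \<times> UNIV"
  shows "\<phi> [inv_letter l] = inv (\<phi> [l])"
proof -
  have mem: "[l] \<in> carrier (free_group X)" "[inv_letter l] \<in> carrier (free_group X)"
    using l by (auto simp: free_group_def inv_letter_def)
  then have "\<phi> [l] \<in> H" "\<phi> [inv_letter l] \<in> H"
    using \<phi> by (auto simp: iso_def hom_def)
  then have "\<phi> [l] \<in> carrier G" "\<phi> [inv_letter l] \<in> carrier G"
    using H by (auto dest: subgroup.mem_carrier)
  moreover have "\<phi> ([inv_letter l] \<otimes>\<^bsub>free_group X\<^esub> [l]) = \<phi> [inv_letter l] \<otimes>\<^bsub>G\<lparr>carrier := H\<rparr>\<^esub> \<phi> [l]"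
    using \<phi> mem by (intro hom_mult) (auto simp: iso_def)
  then have "\<phi> [inv_letter l] \<otimes> \<phi> [l] = \<phi> []"
    by (simp add: free_group_def)
  ultimately show ?thesis
    using iso_free_group_word_value[OF H \<phi>, of "[]"] by (simp add: inv_equality)
qed

section \<open>Coset representatives and normal forms\<close>

lemma (in group) finite_index_transversal:
  assumes H: "subgroup H G" and fin: "finite (rcosets H)"
  obtains T where "finite T" "T \<subseteq> carrier G" "\<one> \<in> T"
    "\<And>g. g \<in> carrier G \<Longrightarrow> \<exists>t\<in>T. g \<otimes> inv t \<in> H"
    "\<And>t t' g h. \<lbrakk>t \<in> T; t' \<in> T; g \<in> H; h \<in> H; g \<otimes> t = h \<otimes> t'\<rbrakk> \<Longrightarrow> t = t'"
proof -
  \<comment> \<open>One element is chosen from each right coset, with \<open>\<one>\<close> forced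
    for \<open>H\<close>, because the machine starts with representative
    \<open>\<one>\<close>.\<close>
  define c where "c C = (if C = H then \<one> else (SOME x. x \<in> C))" for C
  have c: "c C \<in> C" if "C \<in> rcosets H" for C
    using that subgroup.one_closed[OF H] subgroup.rcosets_non_empty[OF H that]
    by (auto simp: c_def some_in_eq)
  have H_coset: "H \<in> rcosets H"
    using subgroup.subgroup_in_rcosets[OF H is_group] .
  have sub: "C \<subseteq> carrier G" if "C \<in> rcosets H" for C
    using subgroup.rcosets_carrier[OF H is_group that] .
  have same: "C = C'" if "C \<in> rcosets H" "C' \<in> rcosets H" "x \<in> C" "x \<in> C'" for C C' x
    using pairwiseD[OF rcos_disjoint[OF H] that(1,2)] that(3,4) by (auto simp: disjnt_iff)
  have coset: "h \<otimes> x \<in> C" if C: "C \<in> rcosets H" and x: "x \<in> C" and h: "h \<in> H" for C x h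
  proof -
    obtain a where a: "a \<in> carrier G" "C = H #> a"
      using C unfolding RCOSETS_def by blast
    then obtain k where k: "k \<in> H" "x = k \<otimes> a"
      using x unfolding r_coset_def by blast
    have "h \<otimes> x = (h \<otimes> k) \<otimes> a"
      unfolding k(2) using a(1) subgroup.mem_carrier[OF H] k(1) h by (simp add: m_assoc)
    moreover have "h \<otimes> k \<in> H"
      using k(1) h by (simp add: subgroup.m_closed[OF H])
    ultimately show ?thesis
      unfolding a(2) r_coset_def by blast
  qed
  show thesis
  proof (rule that[of "c ` (rcosets H)"])
    show "\<one> \<in> c ` (rcosets H)"
      using H_coset by (rule rev_image_eqI) (simp add: c_def)
    show "c ` (rcosets H) \<subseteq> carrier G" using c sub by blast
  next
    fix g assume g: "g \<in> carrier G"
    have C: "H #> g \<in> rcosets H" using g subgroup.subset[OF H] by (auto intro: rcosetsI)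
    then obtain h where h: "h \<in> H" "c (H #> g) = h \<otimes> g"
      using c[OF C] by (auto simp: r_coset_def)
    have "h \<in> carrier G" using H h(1) by (rule subgroup.mem_carrier)
    then have "g \<otimes> inv (h \<otimes> g) = inv h"
      using g by (simp add: inv_mult_group flip: m_assoc)
    then have "g \<otimes> inv (c (H #> g)) \<in> H"
      using h subgroup.m_inv_closed[OF H] by simp
    with C show "\<exists>t\<in>c ` (rcosets H). g \<otimes> inv t \<in> H"
      by blast
  next
    fix t t' g h
    assume "t \<in> c ` (rcosets H)" "t' \<in> c ` (rcosets H)" and gh: "g \<in> H" "h \<in> H" "g \<otimes> t = h \<otimes> t'"
    then obtain C C' where C: "C \<in> rcosets H" "C' \<in> rcosets H" "t = c C" "t' = c C'" by blast
    \<comment> \<open>\<open>g \<otimes> t\<close> lies in \<open>C\<close> and, being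
      \<open>h \<otimes> t'\<close>, also in \<open>C'\<close>; distinct cosets are
      disjoint.\<close>
    then have "C = C'"
      using same[of C C' "g \<otimes> t"] coset[of C t g] coset[of C' t' h] c gh by simp
    with C show "t = t'" by simp
  qed (use fin in simp)
qed

text \<open>Each \<open>t \<otimes> a\<close> is an element of \<open>H\<close> times a
  representative, and that element is the image of a reduced word, which supplies the trail.\<close>

lemma (in group) virtually_free_normal_forms:
  assumes "virtually_free G" and A: "finite A" "A \<subseteq> carrier G"
  obtains Y T trail rep K enc where "normal_form_machine G A Y T trail rep K enc"
proof -
  obtain H X \<phi> where H: "subgroup H G" "finite (rcosets H)"
    and \<phi>: "\<phi> \<in> iso (free_group (X :: 'a set)) (G\<lparr>carrier := H\<rparr>)"
    using assms(1) by (auto simp: virtually_free_def is_free_group_def is_iso_def)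
  obtain T where T: "finite T" "T \<subseteq> carrier G" "\<one> \<in> T"
    and T_rep: "\<And>g. g \<in> carrier G \<Longrightarrow> \<exists>t\<in>T. g \<otimes> inv t \<in> H"
    and T_unique: "\<And>t t' g h. \<lbrakk>t \<in> T; t' \<in> T; g \<in> H; h \<in> H; g \<otimes> t = h \<otimes> t'\<rbrakk> \<Longrightarrow> t = t'"
    using finite_index_transversal[OF H] by metis
  define F where "F = {w \<in> lists (X \<times> (UNIV :: bool set)). reduced_word w}"
  have bij: "bij_betw \<phi> F H"
    using \<phi> by (simp add: iso_def free_group_def F_def)
  define y where "y l = \<phi> [l]" for l
  have map_y: "word_value G (map y w) = \<phi> w" if "w \<in> F" for w
    using iso_free_group_word_value[OF H(1) \<phi>] that by (simp add: F_def y_def[abs_def])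
  have yH: "y l \<in> H" if "l \<in> X \<times> UNIV" for l
    using bij that by (auto simp: y_def F_def bij_betw_def)
  have y_inv: "y (inv_letter l) = inv (y l)" if "l \<in> X \<times> UNIV" for l
    using iso_free_group_inv_letter[OF H(1) \<phi> that] by (simp add: y_def)
  have HG: "H \<subseteq> carrier G" using H(1) subgroup.subset by blast
  have "\<exists>t' w. t' \<in> T \<and> w \<in> F \<and> word_value G (map y w) \<otimes> t' = t \<otimes> a"
    if "t \<in> T" "a \<in> A" for t a
  proof -
    have ta: "t \<in> carrier G" "a \<in> carrier G" using that T A by auto
    then obtain t' where t': "t' \<in> T" "t \<otimes> a \<otimes> inv t' \<in> H"
      using T_rep[of "t \<otimes> a"] by auto
    then obtain w where "w \<in> F" "\<phi> w = t \<otimes> a \<otimes> inv t'"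
      using bij by (metis bij_betw_imp_surj_on imageE)
    moreover have "t' \<in> carrier G" using t' T by auto
    ultimately have "word_value G (map y w) \<otimes> t' = t \<otimes> a"
      using map_y[of w] ta by (simp add: m_assoc)
    with t'(1) \<open>w \<in> F\<close> show ?thesis by blast
  qed
  then obtain rep ls where rep: "\<And>t a. t \<in> T \<Longrightarrow> a \<in> A \<Longrightarrow> rep t a \<in> T"
    and ls: "\<And>t a. t \<in> T \<Longrightarrow> a \<in> A \<Longrightarrow> ls t a \<in> F"
    and ls_rep: "\<And>t a. t \<in> T \<Longrightarrow> a \<in> A \<Longrightarrow> word_value G (map y (ls t a)) \<otimes> rep t a = t \<otimes> a"
    by metis
  \<comment> \<open>Only finitely many words \<open>ls t a\<close> occur, so these letters are
    finite in number whatever the size of \<open>X\<close>.\<close>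
  define L\<^sub>0 where "L\<^sub>0 = (\<Union>t\<in>T. \<Union>a\<in>A. set (ls t a))"
  define L where "L = L\<^sub>0 \<union> inv_letter ` L\<^sub>0"
  \<comment> \<open>The \<open>insert 0\<close> gives \<open>Max\<close> a value when
    \<open>A\<close> is empty.\<close>
  define K where "K = Max (insert 0 ((\<lambda>(t, a). length (ls t a)) ` (T \<times> A)))"
  have L\<^sub>0: "L\<^sub>0 \<subseteq> X \<times> UNIV"
    using ls by (fastforce simp: L\<^sub>0_def F_def)
  then have LX: "L \<subseteq> X \<times> UNIV"
    by (auto simp: L_def inv_letter_def)
  have L_inv: "inv_letter l \<in> L" if "l \<in> L" for l
    using that by (auto simp: L_def)
  have fin: "finite (y ` L)"
    using T A by (simp add: L_def L\<^sub>0_def)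
  \<comment> \<open>Lifts a stack to free letters, choosing any preimages under \<open>y\<close>.
    The lifted word is reduced: \<open>y\<close> respects inverses, so a cancelling pair of letters
    would give a cancelling pair on the stack.\<close>
  have stack: "\<exists>w. r = map y w \<and> w \<in> lists L \<and> rev w \<in> F \<and> stack_value G r = \<phi> (rev w)"
    if r: "set r \<subseteq> y ` L" "inverse_free G r" for r
  proof -
    from r(1) have "r \<in> lists (y ` L)" by auto
    then obtain w where w: "r = map y w" "w \<in> lists L"
      unfolding lists_image by blast
    have "successively (\<lambda>l m. y m \<noteq> inv (y l)) w"
      using r(2) by (simp add: inverse_free_def w(1) successively_map)
    then have "successively (\<lambda>l m. m \<noteq> inv_letter l) w"
    proof (rule successively_mono)
      fix l m assume "l \<in> set w" and y: "y m \<noteq> inv (y l)"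
      then have "l \<in> X \<times> UNIV" using w(2) LX by auto
      then show "m \<noteq> inv_letter l" using y y_inv[of l] by metis
    qed
    then have "reduced_word (rev w)"
      unfolding reduced_word_rev by (simp only: reduced_word_iff)
    moreover have "set w \<subseteq> X \<times> UNIV"
      using w(2) LX by auto
    ultimately have "rev w \<in> F"
      by (simp add: F_def lists_eq_set)
    moreover from this have "stack_value G r = \<phi> (rev w)"
      by (simp add: stack_value_def w(1) rev_map map_y)
    ultimately show ?thesis using w by blast
  qed
  have "finite (control_states (y ` L) T K)"
    using fin T(1) by (rule finite_control_states)
  then obtain enc :: "'a control \<Rightarrow> nat" where enc: "inj_on enc (control_states (y ` L) T K)"
    using finite_imp_inj_to_nat_seg by blast
  have yG: "y ` L \<subseteq> carrier G"
    using yH LX HG by blast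
  have "normal_form_machine G A (y ` L) T (\<lambda>t a. map y (ls t a)) rep K enc"
  \<comment> \<open>Goals 7, 9, 10 and 13 are \<open>Y_inv\<close>, \<open>trail\<close>,
    \<open>trail_length\<close> and \<open>normal_form_unique\<close>.\<close>
  proof (unfold_locales, goal_cases)
    case (7 x)
    then obtain l where "l \<in> L" "x = y l" by blast
    then show ?case using L_inv[of l] LX y_inv[of l] by force
  next
    case (9 t a)
    then show ?case by (force simp: L_def L\<^sub>0_def)
  next
    case (10 t a)
    then show ?case using T A by (auto simp: K_def intro!: Max_ge)
  next
    case (13 r s t t')
    then obtain v w where v: "r = map y v" "rev v \<in> F" "stack_value G r = \<phi> (rev v)"
      and w: "s = map y w" "rev w \<in> F" "stack_value G s = \<phi> (rev w)"
      using stack[OF 13(1,3)] stack[OF 13(2,4)] by blast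
    have mem: "\<phi> (rev v) \<in> H" "\<phi> (rev w) \<in> H"
      using bij v(2) w(2) by (auto simp: bij_betw_def)
    \<comment> \<open>Cosets are compared first; equal representatives can then be cancelled, and
      \<open>\<phi>\<close> is injective on \<open>F\<close>.\<close>
    then have "t = t'"
      using T_unique[of t t' "\<phi> (rev v)" "\<phi> (rev w)"] 13(5-7) v(3) w(3) by simp
    moreover have "t \<in> carrier G" using 13 T by auto
    ultimately have "\<phi> (rev v) = \<phi> (rev w)"
      using 13(7) mem[THEN subsetD[OF HG]] v(3) w(3) by simp
    then have "rev v = rev w"
      using bij v(2) w(2) by (auto simp: bij_betw_def dest: inj_onD)
    with v w \<open>t = t'\<close> show ?case by simp
  qed (use A T fin enc yG rep ls_rep in auto)
  then show ?thesis by (rule that)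
qed

theorem theorem3p1:
  fixes G :: "('a, 'b) monoid_scheme"
  assumes "finitely_generated_group G"
    and "virtually_free G"
  shows "special_co_ET0L_group G"
proof -
  interpret group G using assms(1) by (simp add: finitely_generated_group_def)
  obtain S where S: "finite S" "S \<subseteq> carrier G" "generate G S = carrier G"
    using assms(1) by (auto simp: finitely_generated_group_def)
  define A where "A = S \<union> m_inv G ` S"
  have A: "finite A" "A \<subseteq> carrier G" using S by (auto simp: A_def)
  have "generate G S \<subseteq> generate G A"
    by (rule mono_generate) (simp add: A_def)
  then have "generate G A = carrier G"
    using S(3) generate_incl[OF A(2)] by blast
  moreover have "m_inv G a \<in> A" if "a \<in> A" for a
    using that S(2) by (auto simp: A_def)
  ultimately have gen: "inverse_closed_generating_set G A"
    using A(2) by (simp add: inverse_closed_generating_set_def)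
  obtain Y T trail rep K enc where "normal_form_machine G A Y T trail rep K enc"
    using virtually_free_normal_forms[OF assms(2) A] by blast
  then interpret normal_form_machine G A Y T trail rep K enc .
  show ?thesis
    unfolding special_co_ET0L_group_def
    by (intro conjI exI[of _ A] exI[of _ M])
      (use assms(1) A(1) gen special_cspda_M language_M in auto)
qed

end
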